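(* Let $H_3(\mathbb Z)$ be the discrete Heisenberg group and let $\phi$ be the automorphism of $H_3(\mathbb Z)$ determined by $\phi(\alpha)=(0,2,1)$ and $\phi(\beta)=(0,1,1)$, where $\alpha=(0,1,0)$ and $\beta=(0,0,1)$ (the natural automorphism induced by the matrix $\begin{pmatrix}2&1\\1&1\end{pmatrix}$ of Arnold's cat map). Then $$\log\left(\frac{3+\sqrt5}2\right)\le\mathrm{Entp}(\phi)\le4\log\left(\frac{3+\sqrt5}2\right).$$
   Context: $H_3(\mathbb Z)$ is $\mathbb Z^3$ with multiplication $(x,y,z)\cdot(u,v,w)=(x+u+yw,\,y+v,\,z+w)$; it is generated by $\alpha$ and $\beta$, with presentation $\langle\alpha,\beta:[\alpha,[\alpha,\beta]]=1=[\beta,[\alpha,\beta]]\rangle$. For a finitely generated discrete group $\Gamma$, $C^*_r(\Gamma)$ is the reduced group $C^*$-algebra with norm $\|\cdot\|_{\mathrm{red}}$, $C_c(\Gamma)$ is the dense $*$-subalgebra of finitely supported functions $\sum_{g} c_g\delta_g$ (with convolution product), and $C_c(\Gamma)_1=\{f\in C_c(\Gamma):\|f\|_{\mathrm{red}}\le 1\}$. An automorphism $\phi$ of $\Gamma$ induces an automorphism of $C^*_r(\Gamma)$, also denoted $\phi$, with $\phi(\sum c_g\delta_g)=\sum c_g\delta_{\phi(g)}$. For a subset $Y$ of a normed space $X$ and $\delta>0$, $D(Y,\delta)$ is the infimum of $\dim Z$ over finite-dimensional subspaces $Z\subseteq X$ such that for every $y\in Y$ there is $z\in Z$ with $\|y-z\|<\delta$.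 Product entropy: for finite $\Omega\subseteq C_c(\Gamma)_1$ and $\delta>0$, $\mathrm{Entp}(\phi,\Omega,\delta)=\limsup_{n\to\infty}\frac1n\log D\big(\Omega\,\phi(\Omega)\cdots\phi^{n-1}(\Omega),\delta\big)$ (set of all products $a_0a_1\cdots a_{n-1}$ with $a_i\in\phi^i(\Omega)$, in the normed space $C_r^*(\Gamma)$), and $\mathrm{Entp}(\phi)=\sup_{\Omega}\sup_{\delta>0}\mathrm{Entp}(\phi,\Omega,\delta)$, with $\Omega$ ranging over finite subsets of $C_c(\Gamma)_1$. *)

theory Defs
  imports "HOL-Analysis.Analysis" "HOL-Library.Poly_Mapping"
begin

text \<open>
  Discrete groups are types of class \<^class>\<open>group_add\<close>. This class does not
  assume commutativity; the group law is merely written additively. In particular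
  \<open>'g \<Rightarrow>\<^sub>0 complex\<close> with the library multiplication of \<^type>\<open>poly_mapping\<close> is
  \<open>C\<^sub>c(\<Gamma>)\<close> with its convolution product, and \<open>\<delta>\<^sub>g\<close> is \<open>Poly_Mapping.single g 1\<close>.
\<close>

typedef 'g ell2 = "{f :: 'g \<Rightarrow> complex. (\<lambda>x. (cmod (f x))\<^sup>2) summable_on UNIV}"
  by (rule exI[of _ "\<lambda>_. 0"]) simp

setup_lifting type_definition_ell2

lemma L2_set_le_sqrt_infsum:
  fixes f :: "'g \<Rightarrow> complex"
  assumes "(\<lambda>x. (cmod (f x))\<^sup>2) summable_on UNIV" "finite F"
  shows "L2_set (\<lambda>x. cmod (f x)) F \<le> sqrt (\<Sum>\<^sub>\<infinity>x. (cmod (f x))\<^sup>2)"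
  unfolding L2_set_def using assms
  by (intro real_sqrt_le_mono finite_sum_le_infsum) auto

lemma ell2_boundI:
  fixes f :: "'g \<Rightarrow> complex"
  assumes "\<And>F. finite F \<Longrightarrow> L2_set (\<lambda>x. cmod (f x)) F \<le> B"
  shows "(\<lambda>x. (cmod (f x))\<^sup>2) summable_on UNIV"
    and "sqrt (\<Sum>\<^sub>\<infinity>x. (cmod (f x))\<^sup>2) \<le> B"
proof -
  have B: "0 \<le> B"
    using assms[of "{}"] by simp
  have le: "(\<Sum>x\<in>F. (cmod (f x))\<^sup>2) \<le> B\<^sup>2" if "finite F" for F
  proof -
    have "sqrt (\<Sum>x\<in>F. (cmod (f x))\<^sup>2) \<le> B"
      using assms[OF that] by (simp add: L2_set_def)
    then show ?thesis
      by (rule sqrt_le_D)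
  qed
  show s: "(\<lambda>x. (cmod (f x))\<^sup>2) summable_on UNIV"
    by (rule nonneg_bdd_above_summable_on) (auto intro!: bdd_aboveI2[where M = "B\<^sup>2"] le)
  have "(\<Sum>\<^sub>\<infinity>x. (cmod (f x))\<^sup>2) \<le> B\<^sup>2"
    by (rule infsum_le_finite_sums[OF s]) (auto intro: le)
  then show "sqrt (\<Sum>\<^sub>\<infinity>x. (cmod (f x))\<^sup>2) \<le> B"
    using B by (simp add: real_le_lsqrt)
qed

lemma ell2_add_bound:
  fixes f h :: "'g \<Rightarrow> complex"
  assumes "(\<lambda>x. (cmod (f x))\<^sup>2) summable_on UNIV" "(\<lambda>x. (cmod (h x))\<^sup>2) summable_on UNIV"
    and "finite F"
  shows "L2_set (\<lambda>x. cmod (f x + h x)) F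
    \<le> sqrt (\<Sum>\<^sub>\<infinity>x. (cmod (f x))\<^sup>2) + sqrt (\<Sum>\<^sub>\<infinity>x. (cmod (h x))\<^sup>2)"
proof -
  have "L2_set (\<lambda>x. cmod (f x + h x)) F \<le> L2_set (\<lambda>x. cmod (f x) + cmod (h x)) F"
    by (intro L2_set_mono) (auto intro: norm_triangle_ineq)
  also have "\<dots> \<le> L2_set (\<lambda>x. cmod (f x)) F + L2_set (\<lambda>x. cmod (h x)) F"
    by (rule L2_set_triangle_ineq)
  also have "\<dots> \<le> sqrt (\<Sum>\<^sub>\<infinity>x. (cmod (f x))\<^sup>2) + sqrt (\<Sum>\<^sub>\<infinity>x. (cmod (h x))\<^sup>2)"
    by (intro add_mono L2_set_le_sqrt_infsum assms)
  finally show ?thesis .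
qed

lemma ell2_scale_summable:
  fixes f :: "'g \<Rightarrow> complex"
  assumes "(\<lambda>x. (cmod (f x))\<^sup>2) summable_on UNIV"
  shows "(\<lambda>x. (cmod (c * f x))\<^sup>2) summable_on UNIV"
  using summable_on_cmult_right[OF assms, of "(cmod c)\<^sup>2"]
  by (simp add: norm_mult power_mult_distrib)

lift_definition scale_ell2 :: "complex \<Rightarrow> 'g ell2 \<Rightarrow> 'g ell2" is "\<lambda>c f x. c * f x"
  by (simp add: ell2_scale_summable)

instantiation ell2 :: (type) real_normed_vector
begin

lift_definition zero_ell2 :: "'a ell2" is "\<lambda>_. 0" by simp
lift_definition plus_ell2 :: "'a ell2 \<Rightarrow> 'a ell2 \<Rightarrow> 'a ell2" is "\<lambda>f h x. f x + h x"
  unfolding mem_Collect_eq by (rule ell2_boundI(1), rule ell2_add_bound)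
lift_definition uminus_ell2 :: "'a ell2 \<Rightarrow> 'a ell2" is "\<lambda>f x. - f x" by simp
lift_definition minus_ell2 :: "'a ell2 \<Rightarrow> 'a ell2 \<Rightarrow> 'a ell2" is "\<lambda>f h x. f x - h x"
  unfolding mem_Collect_eq
proof -
  fix f h :: "'a \<Rightarrow> complex"
  assume "(\<lambda>x. (cmod (f x))\<^sup>2) summable_on UNIV" "(\<lambda>x. (cmod (h x))\<^sup>2) summable_on UNIV"
  then show "(\<lambda>x. (cmod (f x - h x))\<^sup>2) summable_on UNIV"
    using ell2_boundI(1)[OF ell2_add_bound[of f "\<lambda>x. - h x"]] by simp
qed
lift_definition scaleR_ell2 :: "real \<Rightarrow> 'a ell2 \<Rightarrow> 'a ell2" is "\<lambda>r f x. complex_of_real r * f x"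
  by (simp only: mem_Collect_eq ell2_scale_summable)
lift_definition norm_ell2 :: "'a ell2 \<Rightarrow> real" is "\<lambda>f. sqrt (\<Sum>\<^sub>\<infinity>x. (cmod (f x))\<^sup>2)" .

definition sgn_ell2 :: "'a ell2 \<Rightarrow> 'a ell2" where "sgn_ell2 x = inverse (norm x) *\<^sub>R x"
definition dist_ell2 :: "'a ell2 \<Rightarrow> 'a ell2 \<Rightarrow> real" where "dist_ell2 x y = norm (x - y)"
definition uniformity_ell2 :: "('a ell2 \<times> 'a ell2) filter"
  where "uniformity_ell2 = (INF e\<in>{0<..}. principal {(x, y). dist x y < e})"
definition open_ell2 :: "'a ell2 set \<Rightarrow> bool"
  where "open_ell2 U \<longleftrightarrow> (\<forall>x\<in>U. \<forall>\<^sub>F (x', y) in uniformity. x' = x \<longrightarrow> y \<in> U)"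

instance
proof
  fix x y z :: "'a ell2" and a b :: real and U :: "'a ell2 set"
  show "dist x y = norm (x - y)" by (simp add: dist_ell2_def)
  show "sgn x = inverse (norm x) *\<^sub>R x" by (simp add: sgn_ell2_def)
  show "uniformity = (INF e\<in>{0<..}. principal {(x, y :: 'a ell2). dist x y < e})"
    by (simp add: uniformity_ell2_def)
  show "open U \<longleftrightarrow> (\<forall>x\<in>U. \<forall>\<^sub>F (x', y) in uniformity. x' = x \<longrightarrow> y \<in> U)"
    by (simp add: open_ell2_def)
  show "x + y + z = x + (y + z)" by transfer (simp add: algebra_simps)
  show "x + y = y + x" by transfer (simp add: algebra_simps)
  show "0 + x = x" by transfer simp
  show "- x + x = 0" by transfer simp
  show "x - y = x + - y" by transfer simp
  show "a *\<^sub>R (x + y) = a *\<^sub>R x + a *\<^sub>R y" by transfer (simp add: algebra_simps)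
  show "(a + b) *\<^sub>R x = a *\<^sub>R x + b *\<^sub>R x" by transfer (simp add: algebra_simps)
  show "a *\<^sub>R b *\<^sub>R x = (a * b) *\<^sub>R x" by transfer (simp add: mult.assoc)
  show "1 *\<^sub>R x = x" by transfer simp
  show "norm x = 0 \<longleftrightarrow> x = 0"
  proof
    assume "norm x = 0"
    then show "x = 0"
    proof transfer
      fix f :: "'a \<Rightarrow> complex"
      assume f: "(\<lambda>x. (cmod (f x))\<^sup>2) summable_on UNIV"
        and "sqrt (\<Sum>\<^sub>\<infinity>x. (cmod (f x))\<^sup>2) = 0"
      then have "(\<Sum>\<^sub>\<infinity>x. (cmod (f x))\<^sup>2) \<le> 0" by simp
      then have "(cmod (f g))\<^sup>2 = 0" for g
        using f by (intro nonneg_infsum_le_0D[where A = UNIV]) auto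
      then show "f = (\<lambda>_. 0)" by auto
    qed
  qed (transfer, simp)
  show "norm (x + y) \<le> norm x + norm y"
    by transfer (rule ell2_boundI(2), simp add: ell2_add_bound)
  show "norm (a *\<^sub>R x) = \<bar>a\<bar> * norm x"
    by transfer (simp add: norm_mult power_mult_distrib infsum_cmult_right' real_sqrt_mult)
qed

end

lemma norm_scale_ell2: "norm (scale_ell2 c x) = cmod c * norm x"
  by transfer (simp add: norm_mult power_mult_distrib infsum_cmult_right' real_sqrt_mult)

lemma scale_ell2_add: "scale_ell2 c (x + y) = scale_ell2 c x + scale_ell2 c y"
  by transfer (simp add: algebra_simps)

lemma scale_ell2_scaleR: "scale_ell2 c (r *\<^sub>R x) = r *\<^sub>R scale_ell2 c x"
  by transfer (simp add: algebra_simps)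

text \<open>
  The library type of bounded operators is real-linear, so complex scalar multiplication
  is added here. All operators in the reduced group C*-algebra below are complex-linear.
\<close>

type_synonym 'g oper = "'g ell2 \<Rightarrow>\<^sub>L 'g ell2"

lemma bounded_linear_scale_ell2:
  fixes T :: "'g ell2 \<Rightarrow> 'g ell2"
  assumes T: "bounded_linear T"
  shows "bounded_linear (\<lambda>\<xi>. scale_ell2 c (T \<xi>))"
proof -
  interpret T: bounded_linear T by fact
  show ?thesis
  proof (rule bounded_linear_intro[where K = "cmod c * onorm T"])
    show "norm (scale_ell2 c (T \<xi>)) \<le> norm \<xi> * (cmod c * onorm T)" for \<xi>
      using mult_left_mono[OF onorm[OF T, of \<xi>], of "cmod c"]
      by (simp add: norm_scale_ell2 mult_ac)
  qed (simp_all add: T.add T.scaleR scale_ell2_add scale_ell2_scaleR)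
qed

definition scale_oper :: "complex \<Rightarrow> 'g oper \<Rightarrow> 'g oper" where
  "scale_oper c T = Blinfun (\<lambda>\<xi>. scale_ell2 c (blinfun_apply T \<xi>))"

lemma scale_oper_apply: "blinfun_apply (scale_oper c T) \<xi> = scale_ell2 c (blinfun_apply T \<xi>)"
  unfolding scale_oper_def
  by (simp add: bounded_linear_Blinfun_apply bounded_linear_scale_ell2 blinfun.bounded_linear_right)

global_interpretation oper: vector_space "scale_oper :: complex \<Rightarrow> 'g oper \<Rightarrow> 'g oper"
proof
  fix a b :: complex and S T :: "'g oper"
  show "scale_oper a (S + T) = scale_oper a S + scale_oper a T"
    by (rule blinfun_eqI) (simp add: scale_oper_apply blinfun.add_left scale_ell2_add)
  show "scale_oper (a + b) S = scale_oper a S + scale_oper b S"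
    by (rule blinfun_eqI, simp add: scale_oper_apply blinfun.add_left, transfer)
      (simp add: algebra_simps)
  show "scale_oper a (scale_oper b S) = scale_oper (a * b) S"
    by (rule blinfun_eqI, simp add: scale_oper_apply, transfer)
      (simp add: mult.assoc)
  show "scale_oper 1 S = S"
    by (rule blinfun_eqI, simp add: scale_oper_apply, transfer) simp
qed

lemma bij_left_translation: "bij (\<lambda>t :: 'g :: group_add. - s + t)"
  by (rule o_bij[where g = "\<lambda>t. s + t"]) (auto simp: fun_eq_iff add.assoc[symmetric])

lift_definition translate_ell2 :: "'g :: group_add \<Rightarrow> 'g ell2 \<Rightarrow> 'g ell2" is "\<lambda>s \<xi> t. \<xi> (- s + t)"
  by (simp add: summable_on_reindex_bij_betw[OF bij_left_translation, of "\<lambda>t. (cmod (_ t))\<^sup>2"])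

lemma norm_translate_ell2: "norm (translate_ell2 s \<xi>) = norm \<xi>"
  by transfer (simp add: infsum_reindex_bij_betw[OF bij_left_translation, of "\<lambda>t. (cmod (_ t))\<^sup>2"])

lemma bounded_linear_translate_ell2: "bounded_linear (translate_ell2 s)"
proof (rule bounded_linear_intro[where K = 1])
  fix \<xi> \<eta> :: "'a ell2" and r :: real
  show "translate_ell2 s (\<xi> + \<eta>) = translate_ell2 s \<xi> + translate_ell2 s \<eta>"
    by transfer simp
  show "translate_ell2 s (r *\<^sub>R \<xi>) = r *\<^sub>R translate_ell2 s \<xi>"
    by transfer simp
  show "norm (translate_ell2 s \<xi>) \<le> norm \<xi> * 1"
    by (simp add: norm_translate_ell2)
qed

definition left_translation :: "'g :: group_add \<Rightarrow> 'g oper" where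
  "left_translation s = Blinfun (translate_ell2 s)"

lemma left_translation_apply: "blinfun_apply (left_translation s) = translate_ell2 s"
  by (simp add: left_translation_def bounded_linear_Blinfun_apply bounded_linear_translate_ell2)

definition reg_rep :: "('g :: group_add \<Rightarrow>\<^sub>0 complex) \<Rightarrow> 'g oper" where
  "reg_rep f = (\<Sum>s\<in>Poly_Mapping.keys f. scale_oper (Poly_Mapping.lookup f s) (left_translation s))"

definition red_norm :: "('g :: group_add \<Rightarrow>\<^sub>0 complex) \<Rightarrow> real" where
  "red_norm f = norm (reg_rep f)"

definition Cstar_red :: "'g :: group_add oper set" where
  "Cstar_red = closure (range reg_rep)"

definition Cc_unit_ball :: "('g :: group_add \<Rightarrow>\<^sub>0 complex) set" where
  "Cc_unit_ball = {f. red_norm f \<le> 1}"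

text \<open>
  \<open>approx_dim X Y \<delta>\<close> is \<open>D(Y, \<delta>)\<close> in the normed space \<open>X\<close>, a complex subspace of the operators;
  dimensions are over the complex numbers. Finite-dimensionality is required separately
  because the library dimension of an infinite-dimensional space is 0. The infimum
  is \<open>\<infinity>\<close> if no finite-dimensional subspace qualifies.
\<close>

definition approx_dim :: "'g oper set \<Rightarrow> 'g oper set \<Rightarrow> real \<Rightarrow> enat" where
  "approx_dim X Y \<delta> = (INF Z \<in> {Z. oper.subspace Z \<and> (\<exists>B. finite B \<and> Z = oper.span B) \<and> Z \<subseteq> X
      \<and> (\<forall>y\<in>Y. \<exists>z\<in>Z. norm (y - z) < \<delta>)}. enat (oper.dim Z))"

fun log_enat :: "enat \<Rightarrow> ereal" where
  "log_enat (enat d) = (if d = 0 then - \<infinity> else ereal (ln (real d)))"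
| "log_enat \<infinity> = \<infinity>"

definition group_automorphism :: "('g :: group_add \<Rightarrow> 'g) \<Rightarrow> bool" where
  "group_automorphism \<phi> \<longleftrightarrow> bij \<phi> \<and> (\<forall>g h. \<phi> (g + h) = \<phi> g + \<phi> h)"

definition induced_aut :: "('g :: group_add \<Rightarrow> 'g) \<Rightarrow> ('g \<Rightarrow>\<^sub>0 complex) \<Rightarrow> ('g \<Rightarrow>\<^sub>0 complex)" where
  "induced_aut \<phi> f =
     (\<Sum>g\<in>Poly_Mapping.keys f. Poly_Mapping.single (\<phi> g) (Poly_Mapping.lookup f g))"

text \<open>Elements are the products \<open>a\<^sub>0 a\<^sub>1 \<dots> a\<^bsub>n-1\<^esub>\<close> with \<open>a\<^sub>i \<in> \<phi>\<^sup>i(\<Omega>)\<close>, in this order.\<close>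

definition orbit_products ::
    "('g :: group_add \<Rightarrow> 'g) \<Rightarrow> ('g \<Rightarrow>\<^sub>0 complex) set \<Rightarrow> nat \<Rightarrow> ('g \<Rightarrow>\<^sub>0 complex) set" where
  "orbit_products \<phi> \<Omega> n =
     {prod_list (map a [0..<n]) | a. \<forall>i<n. a i \<in> (induced_aut \<phi> ^^ i) ` \<Omega>}"

definition Entp_at :: "('g :: group_add \<Rightarrow> 'g) \<Rightarrow> ('g \<Rightarrow>\<^sub>0 complex) set \<Rightarrow> real \<Rightarrow> ereal" where
  "Entp_at \<phi> \<Omega> \<delta> =
     limsup (\<lambda>n. log_enat (approx_dim Cstar_red (reg_rep ` orbit_products \<phi> \<Omega> n) \<delta>) / ereal (real n))"

definition Entp :: "('g :: group_add \<Rightarrow> 'g) \<Rightarrow> ereal" where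
  "Entp \<phi> = (SUP \<Omega> \<in> {\<Omega>. finite \<Omega> \<and> \<Omega> \<subseteq> Cc_unit_ball}. SUP \<delta> \<in> {0<..}. Entp_at \<phi> \<Omega> \<delta>)"

datatype heis = Heis int int int

instantiation heis :: group_add
begin

definition zero_heis :: heis where "zero_heis = Heis 0 0 0"

fun plus_heis :: "heis \<Rightarrow> heis \<Rightarrow> heis" where
  "plus_heis (Heis x y z) (Heis u v w) = Heis (x + u + y * w) (y + v) (z + w)"

fun uminus_heis :: "heis \<Rightarrow> heis" where
  "uminus_heis (Heis x y z) = Heis (y * z - x) (- y) (- z)"

definition minus_heis :: "heis \<Rightarrow> heis \<Rightarrow> heis" where
  "minus_heis g h = g + (- h)"

instance
proof
  fix a b c :: heis
  show "a + b + c = a + (b + c)" by (cases a; cases b; cases c) (simp add: algebra_simps)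
  show "0 + a = a" "a + 0 = a" "- a + a = 0" by (cases a; simp add: zero_heis_def)+
  show "a + - b = a - b" by (simp add: minus_heis_def)
qed

end

definition heis_alpha :: heis where "heis_alpha = Heis 0 1 0"
definition heis_beta :: heis where "heis_beta = Heis 0 0 1"

text \<open>
  Formula for \<open>cat_aut\<close>: \<open>(x, y, z) = c\<^sup>x \<beta>\<^sup>z \<alpha>\<^sup>y\<close> with
  \<open>c = (1, 0, 0) = [\<alpha>, \<beta>]\<close> central, and an automorphism sending \<open>\<alpha>, \<beta>\<close> to
  \<open>(0, 2, 1), (0, 1, 1)\<close> fixes \<open>c\<close> because the matrix has determinant 1.
\<close>

fun cat_aut :: "heis \<Rightarrow> heis" where
  "cat_aut (Heis x y z) =
     Heis (x + z * (z - 1) div 2 + y * (y - 1) + y * z) (2 * y + z) (y + z)"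

lemma group_automorphism_cat_aut: "group_automorphism cat_aut"
  unfolding group_automorphism_def
proof (intro conjI allI)
  have tri: "(z + w) * (z + w - 1) div 2 = z * (z - 1) div 2 + w * (w - 1) div 2 + z * w"
    for z w :: int
  proof -
    have "even (z * (z - 1))" "even (w * (w - 1))" by auto
    then obtain a b where "z * (z - 1) = 2 * a" "w * (w - 1) = 2 * b"
      by (meson evenE)
    moreover from this have "(z + w) * (z + w - 1) = 2 * (a + b + z * w)"
      by (simp add: algebra_simps)
    ultimately show ?thesis by simp
  qed
  show "cat_aut (g + h) = cat_aut g + cat_aut h" for g h
    by (cases g; cases h) (simp add: tri, simp add: algebra_simps)
  show "bij cat_aut"
  proof (rule bijI)
    show "inj cat_aut"
    proof (rule injI)
      fix g h assume "cat_aut g = cat_aut h"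
      moreover obtain x y z u v w where gh: "g = Heis x y z" "h = Heis u v w"
        by (cases g; cases h)
      ultimately have "2 * y + z = 2 * v + w" "y + z = v + w" by auto
      then have "y = v" "z = w" by auto
      with \<open>cat_aut g = cat_aut h\<close> gh show "g = h" by simp
    qed
    show "surj cat_aut"
    proof (rule surjI)
      fix g
      show "cat_aut (case g of Heis u v w \<Rightarrow> (let y = v - w; z = 2 * w - v in
              Heis (u - (z * (z - 1) div 2 + y * (y - 1) + y * z)) y z)) = g"
        by (cases g) (simp add: Let_def)
    qed
  qed
qed

lemma heis_generators_ext:
  fixes \<phi> \<psi> :: "heis \<Rightarrow> heis"
  assumes \<phi>: "\<And>g h. \<phi> (g + h) = \<phi> g + \<phi> h" and \<psi>: "\<And>g h. \<psi> (g + h) = \<psi> g + \<psi> h"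
    and \<alpha>: "\<phi> heis_alpha = \<psi> heis_alpha" and \<beta>: "\<phi> heis_beta = \<psi> heis_beta"
  shows "\<phi> = \<psi>"
proof
  define E where "E = {g. \<phi> g = \<psi> g}"
  have zero: "\<phi> 0 = 0" "\<psi> 0 = 0"
    using \<phi>[of 0 0] \<psi>[of 0 0] by (metis add_0_right add_left_cancel)+
  have neg: "\<phi> (- g) = - \<phi> g" "\<psi> (- g) = - \<psi> g" for g
    using \<phi>[of "- g" g] \<psi>[of "- g" g] zero by (simp_all add: eq_neg_iff_add_eq_0)
  have add: "g + h \<in> E" if "g \<in> E" "h \<in> E" for g h using that by (simp add: E_def \<phi> \<psi>)
  have mns: "- g \<in> E" if "g \<in> E" for g using that by (simp add: E_def neg)
  have E0: "Heis 0 0 0 \<in> E" using zero by (simp add: E_def zero_heis_def)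
  have A: "Heis 0 1 0 \<in> E" and B: "Heis 0 0 1 \<in> E"
    using \<alpha> \<beta> by (simp_all add: E_def heis_alpha_def heis_beta_def)
  have C: "Heis 1 0 0 \<in> E"
    using add[OF add[OF A B] mns[OF add[OF B A]]] by simp
  have x: "Heis n 0 0 \<in> E" for n
  proof (induction n rule: int_induct[where k = 0])
    case (step1 i) then show ?case using add[OF step1(2) C] by simp
  next
    case (step2 i) then show ?case using add[OF step2(2) mns[OF C]] by simp
  qed (rule E0)
  have y: "Heis 0 n 0 \<in> E" for n
  proof (induction n rule: int_induct[where k = 0])
    case (step1 i) then show ?case using add[OF step1(2) A] by simp
  next
    case (step2 i) then show ?case using add[OF step2(2) mns[OF A]] by simp
  qed (rule E0)
  have z: "Heis 0 0 n \<in> E" for n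
  proof (induction n rule: int_induct[where k = 0])
    case (step1 i) then show ?case using add[OF step1(2) B] by simp
  next
    case (step2 i) then show ?case using add[OF step2(2) mns[OF B]] by simp
  qed (rule E0)
  fix g
  obtain a b c where "g = Heis a b c" by (cases g)
  then have "g = Heis a 0 0 + (Heis 0 0 c + Heis 0 b 0)" by simp
  then show "\<phi> g = \<psi> g"
    using add[OF x[of a] add[OF z[of c] y[of b]]] by (simp add: E_def)
qed

lemma ex1_cat_automorphism:
  "\<exists>!\<phi>. group_automorphism \<phi> \<and> \<phi> heis_alpha = Heis 0 2 1 \<and> \<phi> heis_beta = Heis 0 1 1"
proof (rule ex1I[of _ cat_aut])
  show *: "group_automorphism cat_aut \<and> cat_aut heis_alpha = Heis 0 2 1 \<and>
      cat_aut heis_beta = Heis 0 1 1"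
    by (simp add: group_automorphism_cat_aut heis_alpha_def heis_beta_def)
  fix \<phi> assume "group_automorphism \<phi> \<and> \<phi> heis_alpha = Heis 0 2 1 \<and> \<phi> heis_beta = Heis 0 1 1"
  with * show "\<phi> = cat_aut"
    by (intro heis_generators_ext) (auto simp: group_automorphism_def)
qed

end

theory Submission
  imports Defs
begin

text \<open>
  Let \<open>\<lambda> = (3 + sqrt 5) / 2\<close>, the expanding eigenvalue of the cat map. Products along an orbit
  of length \<open>n\<close> are supported in \<open>S \<phi>(S) \<dots> \<phi>\<^bsup>n-1\<^esup>(S)\<close> for a finite set \<open>S\<close>, where the last two
  coordinates are \<open>O(\<lambda>\<^sup>n)\<close> and the central one is \<open>O(\<lambda>\<^bsup>2n\<^esup>)\<close>. This is a set of \<open>O(\<lambda>\<^bsup>4n\<^esup>)\<close> elements,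
  and the translations by them span a space containing all the products.

  Conversely, evaluating operators at \<open>\<delta>\<^sub>0\<close> turns the translations by \<open>N\<close> group elements into \<open>N\<close>
  orthonormal vectors, and by Bessel's inequality (a trace estimate for an orthogonal projection)
  a space that approximates these up to \<open>\<delta>\<close> has dimension at least \<open>(1 - \<delta>\<^sup>2) N / 2\<close> (the factor
  1/2 comes from counting real dimensions). With the digits \<open>0, \<alpha>, \<alpha> + \<alpha>\<close>, the expanding coordinate of
  the orbit products takes all values \<open>\<Sum>\<^sub>i d\<^sub>i \<lambda>\<^sup>i\<close> with \<open>d\<^sub>i \<in> {0, 1, 2}\<close>. As \<open>\<lambda> < 3\<close>, greedy
  expansion puts such a value within distance 1 of every point of \<open>[0, \<lambda>\<^sup>n)\<close>, so \<open>N \<ge> \<lambda>\<^sup>n\<close>.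
\<close>

section \<open>Approximating orthonormal vectors\<close>

text \<open>The projection is the Fourier sum over \<open>C\<close>. If \<open>C\<close> contains 0,
  that term vanishes because division by zero yields 0.\<close>

lemma orthogonal_projection_exists:
  fixes x :: "'a :: real_inner"
  assumes C: "finite C" "pairwise orthogonal C"
  obtains p where "p \<in> span C" "\<And>v. v \<in> span C \<Longrightarrow> orthogonal (x - p) v"
    "(norm p)\<^sup>2 = (\<Sum>c\<in>C. (x \<bullet> c)\<^sup>2 / (c \<bullet> c))"
proof
  let ?p = "\<Sum>c\<in>C. ((x \<bullet> c) / (c \<bullet> c)) *\<^sub>R c"
  have pc: "?p \<bullet> c = x \<bullet> c" if c: "c \<in> C" for c
  proof -
    have "?p \<bullet> c = (\<Sum>d\<in>C. ((x \<bullet> d) / (d \<bullet> d)) * (d \<bullet> c))"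
      by (simp add: inner_sum_left)
    also have "\<dots> = (\<Sum>d\<in>C. if d = c then x \<bullet> c else 0)"
      using C(2) c by (intro sum.cong) (auto simp: pairwise_def orthogonal_def)
    also have "\<dots> = x \<bullet> c" using C(1) c by simp
    finally show ?thesis .
  qed
  show "?p \<in> span C"
    by (intro span_sum span_scale span_base)
  show "orthogonal (x - ?p) v" if "v \<in> span C" for v
    using that
  proof (induction rule: span_induct_alt)
    case base
    show ?case by (simp add: orthogonal_def)
  next
    case (step a c v)
    have "(x - ?p) \<bullet> c = 0" using pc[OF step(1)] by (simp only: inner_diff_left)
    with step(2) show ?case by (simp only: orthogonal_def inner_add_right inner_scaleR_right)
  qed
  have "(norm ?p)\<^sup>2 = (\<Sum>c\<in>C. (x \<bullet> c) / (c \<bullet> c) * (?p \<bullet> c))"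
    unfolding power2_norm_eq_inner by (subst inner_sum_right) simp
  also have "\<dots> = (\<Sum>c\<in>C. (x \<bullet> c)\<^sup>2 / (c \<bullet> c))"
    by (rule sum.cong[OF refl], subst pc) (simp_all add: power2_eq_square)
  finally show "(norm ?p)\<^sup>2 = (\<Sum>c\<in>C. (x \<bullet> c)\<^sup>2 / (c \<bullet> c))" .
qed

text \<open>Pythagoras twice: \<open>x - p\<close> is orthogonal both to \<open>p\<close> and to
  \<open>p - w\<close>, so no \<open>w\<close> in the span is closer to \<open>x\<close> than the
  projection \<open>p\<close>.\<close>

lemma norm_le_projection_plus_dist:
  fixes x w :: "'a :: real_inner"
  assumes C: "finite C" "pairwise orthogonal C" and w: "w \<in> span C"
  shows "(norm x)\<^sup>2 \<le> (\<Sum>c\<in>C. (x \<bullet> c)\<^sup>2 / (c \<bullet> c)) + (norm (x - w))\<^sup>2"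
proof -
  obtain p where p: "p \<in> span C" "\<And>v. v \<in> span C \<Longrightarrow> orthogonal (x - p) v"
      "(norm p)\<^sup>2 = (\<Sum>c\<in>C. (x \<bullet> c)\<^sup>2 / (c \<bullet> c))"
    using orthogonal_projection_exists[OF C, of x] by blast
  have "(norm (x - w))\<^sup>2 = (norm (x - p))\<^sup>2 + (norm (p - w))\<^sup>2"
    using norm_add_Pythagorean[OF p(2)[OF span_diff[OF p(1) w]]] by simp
  moreover have "(norm x)\<^sup>2 = (norm (x - p))\<^sup>2 + (norm p)\<^sup>2"
    using norm_add_Pythagorean[OF p(2)[OF p(1)]] by simp
  ultimately show ?thesis using p(3) by simp
qed

lemma bessel_inequality:
  fixes x :: "'a :: real_inner"
  assumes E: "finite E" "pairwise orthogonal E" "\<And>e. e \<in> E \<Longrightarrow> norm e = 1"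
  shows "(\<Sum>e\<in>E. (e \<bullet> x)\<^sup>2) \<le> x \<bullet> x"
proof -
  obtain p where p: "p \<in> span E" "\<And>v. v \<in> span E \<Longrightarrow> orthogonal (x - p) v"
      "(norm p)\<^sup>2 = (\<Sum>e\<in>E. (x \<bullet> e)\<^sup>2 / (e \<bullet> e))"
    using orthogonal_projection_exists[OF E(1,2), of x] by blast
  have "(\<Sum>e\<in>E. (e \<bullet> x)\<^sup>2) = (\<Sum>e\<in>E. (x \<bullet> e)\<^sup>2 / (e \<bullet> e))"
    using E(3) by (intro sum.cong) (auto simp: norm_eq_1 inner_commute)
  also have "\<dots> \<le> (norm x)\<^sup>2"
    using norm_add_Pythagorean[OF p(2)[OF p(1)]] p(3) by simp
  finally show ?thesis by (simp add: power2_norm_eq_inner)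
qed

text \<open>Count the double sum of \<open>(e \<bullet> c)\<^sup>2 / (c \<bullet> c)\<close> in two
  ways. For fixed \<open>e\<close> it is at least \<open>1 - \<delta>\<^sup>2\<close>, as
  \<open>e\<close> is close to the span; for fixed \<open>c\<close> it is at most 1 by
  Bessel.\<close>

lemma card_orthonormal_approx_le:
  fixes E B :: "'a :: real_inner set"
  assumes E: "finite E" "pairwise orthogonal E" "\<And>e. e \<in> E \<Longrightarrow> norm e = 1"
    and B: "finite B" and approx: "\<And>e. e \<in> E \<Longrightarrow> \<exists>w\<in>span B. norm (e - w) < \<delta>"
  shows "(1 - \<delta>\<^sup>2) * card E \<le> card B"
proof -
  obtain C where C: "finite C" "card C \<le> card B" "span C = span B" "pairwise orthogonal C"
    using basis_orthogonal[OF B] by blast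
  have "(1 - \<delta>\<^sup>2) \<le> (\<Sum>c\<in>C. (e \<bullet> c)\<^sup>2 / (c \<bullet> c))" if e: "e \<in> E" for e
  proof -
    obtain w where w: "w \<in> span C" "norm (e - w) < \<delta>"
      using approx[OF e] C(3) by auto
    have "norm (e - w) ^ 2 \<le> \<delta>\<^sup>2" using w(2) by (intro power_mono) auto
    then show ?thesis
      using norm_le_projection_plus_dist[OF C(1,4) w(1), of e] E(3)[OF e] by simp
  qed
  then have "(1 - \<delta>\<^sup>2) * card E \<le> (\<Sum>e\<in>E. \<Sum>c\<in>C. (e \<bullet> c)\<^sup>2 / (c \<bullet> c))"
    using sum_bounded_below[of E "1 - \<delta>\<^sup>2"] by (simp add: mult.commute)
  also have "\<dots> = (\<Sum>c\<in>C. (\<Sum>e\<in>E. (e \<bullet> c)\<^sup>2) / (c \<bullet> c))"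
    by (subst sum.swap) (simp add: sum_divide_distrib)
  also have "\<dots> \<le> (\<Sum>c\<in>C. 1)"
    by (intro sum_mono) (auto simp: divide_le_eq_1 less_le intro!: bessel_inequality E)
  also have "\<dots> \<le> card B" using C(2) by simp
  finally show ?thesis .
qed

section \<open>The Hilbert space of square-summable functions\<close>

lemma summable_on_inner:
  fixes f h :: "'g \<Rightarrow> complex"
  assumes f: "(\<lambda>x. (cmod (f x))\<^sup>2) summable_on UNIV" and h: "(\<lambda>x. (cmod (h x))\<^sup>2) summable_on UNIV"
  shows "(\<lambda>x. f x \<bullet> h x) summable_on UNIV"
proof -
  have "\<bar>f x \<bullet> h x\<bar> \<le> (cmod (f x))\<^sup>2 + (cmod (h x))\<^sup>2" for x
  proof -
    have "\<bar>f x \<bullet> h x\<bar> \<le> cmod (f x) * cmod (h x)"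
      by (rule Cauchy_Schwarz_ineq2)
    also have "\<dots> \<le> (cmod (f x))\<^sup>2 + (cmod (h x))\<^sup>2"
      using sum_squares_bound[of "cmod (f x)" "cmod (h x)"]
        mult_nonneg_nonneg[OF norm_ge_zero[of "f x"] norm_ge_zero[of "h x"]] by linarith
    finally show ?thesis .
  qed
  then have "(\<lambda>x. norm (f x \<bullet> h x)) summable_on UNIV"
    using summable_on_add[OF f h] by (intro Infinite_Sum.abs_summable_on_comparison_test') auto
  then show ?thesis by (rule abs_summable_summable)
qed

instantiation ell2 :: (type) real_inner
begin

text \<open>On \<open>complex\<close>, \<open>\<bullet>\<close> is the real part of the Hermitian
  product, so this real inner product induces the norm already defined.\<close>

lift_definition inner_ell2 :: "'a ell2 \<Rightarrow> 'a ell2 \<Rightarrow> real" is "\<lambda>f h. \<Sum>\<^sub>\<infinity>x. f x \<bullet> h x" .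

instance
proof
  fix x y z :: "'a ell2" and r :: real
  show "x \<bullet> y = y \<bullet> x" by transfer (simp add: inner_commute)
  show "(x + y) \<bullet> z = x \<bullet> z + y \<bullet> z"
    by transfer (simp add: inner_add_left infsum_add summable_on_inner)
  show "(r *\<^sub>R x) \<bullet> y = r * (x \<bullet> y)"
    by transfer (simp flip: scaleR_conv_of_real infsum_cmult_right')
  show "0 \<le> x \<bullet> x" by transfer (simp add: infsum_nonneg)
  show *: "norm x = sqrt (x \<bullet> x)"
    by transfer (simp add: power2_norm_eq_inner)
  show "x \<bullet> x = 0 \<longleftrightarrow> x = 0"
    using * \<open>0 \<le> x \<bullet> x\<close> by (metis norm_eq_zero real_sqrt_eq_zero_cancel real_sqrt_zero)
qed

end

lemma summable_on_delta: "(\<lambda>x. (cmod (if x = g then 1 else 0))\<^sup>2) summable_on UNIV"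
proof -
  have "(\<lambda>x. (cmod (if x = g then 1 else 0))\<^sup>2) summable_on UNIV
      \<longleftrightarrow> (\<lambda>x. (cmod (if x = g then 1 else 0))\<^sup>2) summable_on {g}"
    by (rule summable_on_cong_neutral) auto
  then show ?thesis by simp
qed

lift_definition delta_ell2 :: "'g \<Rightarrow> 'g ell2" is "\<lambda>g x. if x = g then 1 else 0"
  by (simp only: mem_Collect_eq summable_on_delta)

lemma inner_delta_ell2: "delta_ell2 g \<bullet> delta_ell2 h = (if g = h then 1 else 0)"
proof transfer
  fix g h :: 'g
  have "(\<Sum>\<^sub>\<infinity>x. (if x = g then 1 :: complex else 0) \<bullet> (if x = h then 1 else 0))
      = (\<Sum>\<^sub>\<infinity>x\<in>{g}. (if x = g then 1 :: complex else 0) \<bullet> (if x = h then 1 else 0))"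
    by (rule infsum_cong_neutral) auto
  then show "(\<Sum>\<^sub>\<infinity>x. (if x = g then 1 :: complex else 0) \<bullet> (if x = h then 1 else 0))
      = (if g = h then 1 else 0)"
    by simp
qed

lemma left_translation_delta_0: "blinfun_apply (left_translation g) (delta_ell2 0) = delta_ell2 g"
  unfolding left_translation_apply
  by transfer (metis neg_equal_iff_equal add_left_cancel add.right_neutral add.left_inverse)

lemma norm_left_translation_le: "norm (left_translation g) \<le> 1"
  by (rule norm_blinfun_bound) (simp_all add: left_translation_apply norm_translate_ell2)

text \<open>Complex multiples of \<open>x\<close> lie in the real span of \<open>x\<close> and
  \<open>scale_ell2 \<i> x\<close>. This is where the dimension count doubles.\<close>

lemma scale_ell2_eq:
  "scale_ell2 c x = Re c *\<^sub>R x + Im c *\<^sub>R scale_ell2 \<i> x"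
  by transfer (simp add: fun_eq_iff complex_eq_iff)

section \<open>The approximation dimension\<close>

text \<open>Evaluation at the unit vector \<open>delta_ell2 0\<close> is contractive and sends
  distinct translations to orthonormal vectors. A complex basis \<open>B\<close> of the
  approximating space yields at most \<open>2 * card B\<close> real spanning vectors.\<close>

lemma approx_dim_ge:
  fixes F :: "'g :: group_add set"
  assumes F: "finite F" "left_translation ` F \<subseteq> Y"
  shows "enat (nat \<lceil>(1 - \<delta>\<^sup>2) / 2 * card F\<rceil>) \<le> approx_dim X Y \<delta>"
  unfolding approx_dim_def
proof (rule INF_greatest, clarify)
  fix B0 :: "'g oper set"
  define Z where "Z = oper.span B0"
  assume B0: "finite B0" and approx: "\<forall>y\<in>Y. \<exists>z\<in>oper.span B0. norm (y - z) < \<delta>"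
  obtain B where B: "B \<subseteq> Z" "\<not> oper.dependent B" "Z \<subseteq> oper.span B" "card B = oper.dim Z"
    using oper.basis_exists by blast
  have fB: "finite B"
    using oper.independent_span_bound[OF B0 B(2)] B(1) by (simp add: Z_def)
  define D where
    "D = (\<lambda>b. blinfun_apply b (delta_ell2 0)) ` B
       \<union> (\<lambda>b. scale_ell2 \<i> (blinfun_apply b (delta_ell2 0))) ` B"
  have D: "finite D" using fB by (simp add: D_def)
  have cD: "card D \<le> 2 * card B"
    unfolding D_def
    using card_Un_le[of "(\<lambda>b. blinfun_apply b (delta_ell2 0)) ` B"
        "(\<lambda>b. scale_ell2 \<i> (blinfun_apply b (delta_ell2 0))) ` B"]
      card_image_le[OF fB, of "\<lambda>b. blinfun_apply b (delta_ell2 0)"]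
      card_image_le[OF fB, of "\<lambda>b. scale_ell2 \<i> (blinfun_apply b (delta_ell2 0))"]
    by linarith
  have Zspan: "blinfun_apply T (delta_ell2 0) \<in> span D" if T: "T \<in> Z" for T
  proof -
    obtain u where u: "T = (\<Sum>b\<in>B. scale_oper (u b) b)"
      using T B(3) oper.span_finite[OF fB] by auto
    have "blinfun_apply T (delta_ell2 0) = (\<Sum>b\<in>B. scale_ell2 (u b) (blinfun_apply b (delta_ell2 0)))"
      by (simp add: u blinfun.sum_left scale_oper_apply)
    also have "\<dots> \<in> span D"
      by (subst scale_ell2_eq, intro span_sum span_add span_scale span_base)
        (auto simp: D_def)
    finally show ?thesis .
  qed
  have "(1 - \<delta>\<^sup>2) * card (delta_ell2 ` F) \<le> card D"
  proof (rule card_orthonormal_approx_le)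
    show "finite (delta_ell2 ` F)" using F(1) by simp
    show "pairwise orthogonal (delta_ell2 ` F)"
      by (auto simp: pairwise_def orthogonal_def inner_delta_ell2)
    show "norm e = 1" if "e \<in> delta_ell2 ` F" for e
      using that by (auto simp: norm_eq_1 inner_delta_ell2)
    show "\<exists>w\<in>span D. norm (e - w) < \<delta>" if e: "e \<in> delta_ell2 ` F" for e
    proof -
      obtain g where g: "g \<in> F" "e = delta_ell2 g" using e by auto
      obtain T where T: "T \<in> Z" "norm (left_translation g - T) < \<delta>"
        using approx F(2) g(1) unfolding Z_def by blast
      have nd: "norm (delta_ell2 0 :: 'g ell2) = 1"
        by (simp add: norm_eq_1 inner_delta_ell2)
      have "norm (e - blinfun_apply T (delta_ell2 0)) \<le> norm (left_translation g - T)"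
        using norm_blinfun[of "left_translation g - T" "delta_ell2 0"]
        by (simp add: g(2) blinfun.diff_left left_translation_delta_0 nd)
      then show ?thesis using Zspan[OF T(1)] T(2) by force
    qed
  qed (rule D)
  moreover have "inj_on delta_ell2 F"
    by (rule inj_onI) (metis inner_delta_ell2 zero_neq_one)
  ultimately have "(1 - \<delta>\<^sup>2) * card F \<le> 2 * card B"
    using cD by (simp add: card_image)
  then show "enat (nat \<lceil>(1 - \<delta>\<^sup>2) / 2 * card F\<rceil>) \<le> enat (oper.dim (oper.span B0))"
    using B(4) by (simp add: Z_def nat_le_iff ceiling_le_iff)
qed

lemma reg_rep_eq_sum:
  assumes "finite A" "Poly_Mapping.keys f \<subseteq> A"
  shows "reg_rep f = (\<Sum>s\<in>A. scale_oper (Poly_Mapping.lookup f s) (left_translation s))"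
  unfolding reg_rep_def using assms
  by (intro sum.mono_neutral_left) (auto simp: in_keys_iff)

lemma reg_rep_single: "reg_rep (Poly_Mapping.single g 1) = left_translation g"
  by (subst reg_rep_eq_sum[of "{g}"]) auto

lemma subspace_range_reg_rep: "oper.subspace (range reg_rep)"
proof (rule oper.subspaceI)
  show "0 \<in> range reg_rep" by (rule image_eqI[of _ _ 0]) (auto simp: reg_rep_def)
next
  fix S T :: "'a oper" assume "S \<in> range reg_rep" "T \<in> range reg_rep"
  then obtain f h where fh: "S = reg_rep f" "T = reg_rep h" by auto
  let ?A = "Poly_Mapping.keys f \<union> Poly_Mapping.keys h"
  have "reg_rep (f + h) = S + T"
    using Poly_Mapping.keys_add[of f h]
    by (simp add: fh reg_rep_eq_sum[of ?A] lookup_add oper.scale_left_distrib sum.distrib)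
  then show "S + T \<in> range reg_rep" by (metis rangeI)
next
  fix c and T :: "'a oper" assume "T \<in> range reg_rep"
  then obtain f where f: "T = reg_rep f" by auto
  let ?h = "Poly_Mapping.map ((*) c) f"
  have l: "Poly_Mapping.lookup ?h s = c * Poly_Mapping.lookup f s" for s
    by (simp add: Poly_Mapping.map.rep_eq when_def)
  have "reg_rep ?h = scale_oper c T"
    using reg_rep_eq_sum[of "Poly_Mapping.keys f" ?h]
    by (auto simp: in_keys_iff l subset_iff f reg_rep_def oper.scale_sum_right)
  then show "scale_oper c T \<in> range reg_rep" by (metis rangeI)
qed

text \<open>Elements supported in \<open>K\<close> lie in the span of the translations by
  \<open>K\<close>, so they are approximated with error 0.\<close>

lemma approx_dim_Cstar_red_le:
  assumes K: "finite K" and Y: "\<And>f. f \<in> Y \<Longrightarrow> Poly_Mapping.keys f \<subseteq> K" and \<delta>: "0 < \<delta>"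
  shows "approx_dim Cstar_red (reg_rep ` Y) \<delta> \<le> enat (card K)"
proof -
  let ?Z = "oper.span (left_translation ` K)"
  have sub: "?Z \<subseteq> Cstar_red"
  proof -
    have "?Z \<subseteq> range reg_rep"
      by (rule oper.span_minimal[OF _ subspace_range_reg_rep]) (auto simp flip: reg_rep_single)
    then show ?thesis using closure_subset unfolding Cstar_red_def by blast
  qed
  have mem: "reg_rep f \<in> ?Z" if "f \<in> Y" for f
    unfolding reg_rep_def using Y[OF that]
    by (intro oper.span_sum oper.span_scale oper.span_base) auto
  have "approx_dim Cstar_red (reg_rep ` Y) \<delta> \<le> enat (oper.dim ?Z)"
    unfolding approx_dim_def
  proof (rule INF_lower, unfold mem_Collect_eq, intro conjI ballI)
    show "oper.subspace ?Z" by (rule oper.subspace_span)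
    show "\<exists>B. finite B \<and> ?Z = oper.span B" using K by blast
    show "\<exists>z\<in>?Z. norm (y - z) < \<delta>" if "y \<in> reg_rep ` Y" for y
      using mem that \<delta> by force
  qed (rule sub)
  also have "oper.dim ?Z \<le> card (left_translation ` K)"
    using K by (intro oper.dim_le_card) auto
  also have "\<dots> \<le> card K" using K by (rule card_image_le)
  finally show ?thesis by simp
qed

section \<open>Growth rates of dimensions and entropy\<close>

lemma log_enat_le:
  assumes "d \<le> enat m" "real m \<le> r" "0 < r"
  shows "log_enat d \<le> ereal (ln r)"
  using assms by (cases d) auto

text \<open>Positivity of \<open>r\<close> excludes \<open>d = 0\<close>, where
  \<open>log_enat\<close> is \<open>- \<infinity>\<close>.\<close>

lemma log_enat_ge:
  assumes "enat m \<le> d" "r \<le> real m" "0 < r"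
  shows "ereal (ln r) \<le> log_enat d"
  using assms by (cases d) auto

lemma tendsto_ln_mult_exp_rate:
  fixes C \<kappa> :: real
  assumes "0 < C" "0 < \<kappa>"
  shows "(\<lambda>n. ereal (ln (C * \<kappa> ^ n) / real n)) \<longlonglongrightarrow> ereal (ln \<kappa>)"
proof -
  have "(\<lambda>n. ln C / real n + ln \<kappa>) \<longlonglongrightarrow> 0 + ln \<kappa>"
    by (intro tendsto_add tendsto_const lim_const_over_n)
  \<comment> \<open>At \<open>n = 0\<close> division by zero would turn the right-hand side into 0,
    so positive \<open>n\<close> are selected.\<close>
  moreover have "\<forall>\<^sub>F n in sequentially. ln C / real n + ln \<kappa> = ln (C * \<kappa> ^ n) / real n"
    using eventually_gt_at_top[of 0]
    by eventually_elim (use assms in \<open>simp add: ln_mult ln_realpow field_simps\<close>)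
  ultimately show ?thesis
    by (simp add: tendsto_ereal Lim_transform_eventually)
qed

text \<open>The factor \<open>C\<close> contributes only \<open>ln C / n\<close>, which vanishes in
  the limit.\<close>

lemma Entp_at_le:
  assumes "0 < C" "0 < \<kappa>"
    and "\<And>n. \<exists>m. approx_dim Cstar_red (reg_rep ` orbit_products \<phi> \<Omega> n) \<delta> \<le> enat m \<and> real m \<le> C * \<kappa> ^ n"
  shows "Entp_at \<phi> \<Omega> \<delta> \<le> ereal (ln \<kappa>)"
proof -
  have "Entp_at \<phi> \<Omega> \<delta> \<le> limsup (\<lambda>n. ereal (ln (C * \<kappa> ^ n) / real n))"
    unfolding Entp_at_def
  proof (rule Limsup_mono)
    show "\<forall>\<^sub>F n in sequentially. log_enat (approx_dim Cstar_red (reg_rep ` orbit_products \<phi> \<Omega> n) \<delta>)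
        / ereal (real n) \<le> ereal (ln (C * \<kappa> ^ n) / real n)"
      using eventually_gt_at_top[of 0]
    proof eventually_elim
      case (elim n)
      have "log_enat (approx_dim Cstar_red (reg_rep ` orbit_products \<phi> \<Omega> n) \<delta>) \<le> ereal (ln (C * \<kappa> ^ n))"
        using assms(3)[of n] assms(1,2) by (auto intro: log_enat_le)
      from ereal_divide_right_mono[OF this, of "ereal (real n)"] elim show ?case by simp
    qed
  qed
  also have "\<dots> = ereal (ln \<kappa>)"
    by (intro lim_imp_Limsup tendsto_ln_mult_exp_rate assms) simp
  finally show ?thesis .
qed

lemma Entp_at_ge:
  assumes "0 < C" "0 < \<kappa>"
    and "\<And>n. \<exists>m. enat m \<le> approx_dim Cstar_red (reg_rep ` orbit_products \<phi> \<Omega> n) \<delta> \<and> C * \<kappa> ^ n \<le> real m"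
  shows "ereal (ln \<kappa>) \<le> Entp_at \<phi> \<Omega> \<delta>"
proof -
  have "ereal (ln \<kappa>) = limsup (\<lambda>n. ereal (ln (C * \<kappa> ^ n) / real n))"
    by (intro lim_imp_Limsup[symmetric] tendsto_ln_mult_exp_rate assms) simp
  also have "\<dots> \<le> Entp_at \<phi> \<Omega> \<delta>"
    unfolding Entp_at_def
  proof (rule Limsup_mono)
    show "\<forall>\<^sub>F n in sequentially. ereal (ln (C * \<kappa> ^ n) / real n)
        \<le> log_enat (approx_dim Cstar_red (reg_rep ` orbit_products \<phi> \<Omega> n) \<delta>) / ereal (real n)"
      using eventually_gt_at_top[of 0]
    proof eventually_elim
      case (elim n)
      have "ereal (ln (C * \<kappa> ^ n)) \<le> log_enat (approx_dim Cstar_red (reg_rep ` orbit_products \<phi> \<Omega> n) \<delta>)"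
        using assms(3)[of n] assms(1,2) by (auto intro: log_enat_ge)
      from ereal_divide_right_mono[OF this, of "ereal (real n)"] elim show ?case by simp
    qed
  qed
  finally show ?thesis .
qed

section \<open>Products along an orbit\<close>

text \<open>The counterpart of \<open>orbit_products\<close> inside the group, with the factors in
  the same order.\<close>

definition orbit_sums :: "('g :: group_add \<Rightarrow> 'g) \<Rightarrow> 'g set \<Rightarrow> nat \<Rightarrow> 'g set" where
  "orbit_sums \<phi> S n = {sum_list (map s [0..<n]) | s. \<forall>i<n. s i \<in> (\<phi> ^^ i) ` S}"

lemma orbit_sums_0: "orbit_sums \<phi> S 0 = {0}"
  by (simp add: orbit_sums_def)

lemma orbit_sums_SucI:
  assumes "g \<in> orbit_sums \<phi> S n" "h \<in> S"
  shows "g + (\<phi> ^^ n) h \<in> orbit_sums \<phi> S (Suc n)"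
proof -
  obtain s where s: "g = sum_list (map s [0..<n])" "\<forall>i<n. s i \<in> (\<phi> ^^ i) ` S"
    using assms(1) by (auto simp: orbit_sums_def)
  have "map (s(n := (\<phi> ^^ n) h)) [0..<n] = map s [0..<n]" by simp
  then show ?thesis
    unfolding orbit_sums_def using s assms(2)
    by (intro CollectI exI[of _ "s(n := (\<phi> ^^ n) h)"]) (auto simp: less_Suc_eq)
qed

lemma induced_aut_single: "induced_aut \<phi> (Poly_Mapping.single g c) = Poly_Mapping.single (\<phi> g) c"
  by (cases "c = 0") (simp_all add: induced_aut_def)

text \<open>Passing from \<open>g\<close> to its point mass is multiplicative and intertwines
  \<open>\<phi>\<close> with \<open>induced_aut \<phi>\<close>.\<close>

lemma single_orbit_sums:
  assumes "g \<in> orbit_sums \<phi> S n"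
  shows "Poly_Mapping.single g 1 \<in> orbit_products \<phi> ((\<lambda>g. Poly_Mapping.single g 1) ` S) n"
proof -
  obtain s where s: "g = sum_list (map s [0..<n])" "\<forall>i<n. s i \<in> (\<phi> ^^ i) ` S"
    using assms by (auto simp: orbit_sums_def)
  have prod: "Poly_Mapping.single (sum_list xs) (1 :: complex)
      = prod_list (map (\<lambda>g. Poly_Mapping.single g 1) xs)" for xs :: "'a list"
    by (induction xs) (simp_all, metis mult_single mult_1)
  have iter: "(induced_aut \<phi> ^^ i) (Poly_Mapping.single h c) = Poly_Mapping.single ((\<phi> ^^ i) h) c"
    for i h and c :: complex
    by (induction i) (simp_all add: induced_aut_single)
  show ?thesis
    unfolding orbit_products_def
  proof (intro CollectI exI[of _ "\<lambda>i. Poly_Mapping.single (s i) 1"] conjI allI impI)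
    show "Poly_Mapping.single g (1 :: complex) = prod_list (map (\<lambda>i. Poly_Mapping.single (s i) 1) [0..<n])"
      using prod[of "map s [0..<n]"] by (simp add: s(1) comp_def)
  next
    fix i assume "i < n"
    then obtain h where "h \<in> S" "s i = (\<phi> ^^ i) h" using s(2) by blast
    then show "Poly_Mapping.single (s i) (1 :: complex)
        \<in> (induced_aut \<phi> ^^ i) ` (\<lambda>g. Poly_Mapping.single g 1) ` S"
      by (auto simp flip: iter)
  qed
qed

text \<open>Only an inclusion for general \<open>\<phi>\<close>: coefficients at points with the
  same image may cancel.\<close>

lemma keys_induced_aut_pow:
  "Poly_Mapping.keys ((induced_aut \<phi> ^^ i) f) \<subseteq> (\<phi> ^^ i) ` Poly_Mapping.keys f"
proof (induction i)
  case (Suc i)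
  have "Poly_Mapping.keys (induced_aut \<phi> h) \<subseteq> \<phi> ` Poly_Mapping.keys h" for h
    unfolding induced_aut_def
    by (rule order_trans[OF Poly_Mapping.keys_sum]) (auto split: if_splits)
  then show ?case using Suc by (fastforce simp: image_iff)
qed simp

text \<open>The support of a convolution product lies in the product of the supports, so any family
  \<open>K\<close> that absorbs the next factor on the right bounds the supports.\<close>

lemma keys_orbit_products:
  assumes S: "\<And>f. f \<in> \<Omega> \<Longrightarrow> Poly_Mapping.keys f \<subseteq> S"
    and zero: "0 \<in> K 0" and K: "\<And>n g h. g \<in> K n \<Longrightarrow> h \<in> S \<Longrightarrow> g + (\<phi> ^^ n) h \<in> K (Suc n)"
    and f: "f \<in> orbit_products \<phi> \<Omega> n"
  shows "Poly_Mapping.keys f \<subseteq> K n"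
proof -
  obtain a where a: "f = prod_list (map a [0..<n])" "\<forall>i<n. a i \<in> (induced_aut \<phi> ^^ i) ` \<Omega>"
    using f by (auto simp: orbit_products_def)
  \<comment> \<open>The induction runs over prefixes, because the choice \<open>a\<close> is fixed
    for length \<open>n\<close>.\<close>
  have "m \<le> n \<Longrightarrow> Poly_Mapping.keys (prod_list (map a [0..<m])) \<subseteq> K m" for m
  proof (induction m)
    case (Suc m)
    show ?case
    proof
      fix k assume "k \<in> Poly_Mapping.keys (prod_list (map a [0..<Suc m]))"
      then obtain g h where gh: "k = g + h" "g \<in> Poly_Mapping.keys (prod_list (map a [0..<m]))"
          "h \<in> Poly_Mapping.keys (a m)"
        using keys_mult[of "prod_list (map a [0..<m])" "a m"] by auto
      obtain w where "w \<in> \<Omega>" "a m = (induced_aut \<phi> ^^ m) w" using a(2) Suc.prems by (meson Suc_le_lessD imageE)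
      then obtain h' where "h' \<in> S" "h = (\<phi> ^^ m) h'"
        using gh(3) subsetD[OF keys_induced_aut_pow, of h m \<phi> w] S[of w] by (metis imageE subsetD)
      then show "k \<in> K (Suc m)" using K[of g m h'] gh(1,2) Suc by auto
    qed
  qed (use zero in simp)
  then show ?thesis using a(1) by simp
qed

section \<open>The cat map automorphism\<close>

definition cat_eig :: real where "cat_eig = (3 + sqrt 5) / 2"

text \<open>The characteristic equation: the cat matrix has trace 3 and determinant 1.\<close>

lemma cat_eig_sq: "cat_eig * cat_eig = 3 * cat_eig - 1"
  by (simp add: cat_eig_def field_simps)

lemma cat_eig_bounds: "5 / 2 < cat_eig" "cat_eig < 3"
proof -
  have "2 < sqrt 5" "sqrt 5 < 3"
    by (simp_all add: real_less_rsqrt real_less_lsqrt)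
  then show "5 / 2 < cat_eig" "cat_eig < 3" by (simp_all add: cat_eig_def)
qed

text \<open>
  \<open>(1, cat_eig - 2)\<close> is an eigenvector of the cat matrix for \<open>cat_eig\<close>; with this shape the boxes
  \<open>Q r = {g. heis_box r g}\<close>
  satisfy \<open>\<phi>(Q r) \<subseteq> Q (cat_eig * r)\<close> for \<open>r \<ge> 1\<close> and \<open>Q r + Q s \<subseteq> Q (r + s)\<close> without constants.
\<close>

fun heis_box :: "real \<Rightarrow> heis \<Rightarrow> bool" where
  "heis_box r (Heis x y z) \<longleftrightarrow>
     \<bar>real_of_int x\<bar> \<le> r\<^sup>2 \<and> \<bar>real_of_int y\<bar> \<le> r \<and> \<bar>real_of_int z\<bar> \<le> (cat_eig - 2) * r"

lemma heis_box_nonneg: "heis_box r g \<Longrightarrow> 0 \<le> r"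
  by (cases g) auto

lemma heis_box_mono:
  assumes "heis_box r g" "r \<le> s"
  shows "heis_box s g"
proof (cases g)
  case (Heis x y z)
  have "r\<^sup>2 \<le> s\<^sup>2" using assms heis_box_nonneg by (intro power_mono) auto
  moreover have "(cat_eig - 2) * r \<le> (cat_eig - 2) * s"
    using assms(2) cat_eig_bounds by (intro mult_left_mono) auto
  ultimately show ?thesis using assms by (auto simp: Heis)
qed

text \<open>The twist \<open>y * w\<close> is at most \<open>r * s\<close>, which the cross term of
  \<open>(r + s)\<^sup>2\<close> absorbs; hence the quadratic bound on the central
  coordinate.\<close>

lemma heis_box_add:
  assumes "heis_box r g" "heis_box s h"
  shows "heis_box (r + s) (g + h)"
proof -
  obtain x y z u v w where gh: "g = Heis x y z" "h = Heis u v w" by (cases g; cases h)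
  have "\<bar>real_of_int w\<bar> \<le> s"
    using assms(2) mult_right_mono[of "cat_eig - 2" 1 s] heis_box_nonneg[OF assms(2)] cat_eig_bounds
    by (auto simp: gh)
  then have "\<bar>real_of_int y * w\<bar> \<le> r * s"
    using assms by (auto simp: gh abs_mult intro: mult_mono)
  moreover have "0 \<le> r * s" using assms by (simp add: heis_box_nonneg)
  ultimately have "\<bar>real_of_int x + u + real_of_int y * w\<bar> \<le> (r + s)\<^sup>2"
    using assms by (auto simp: gh power2_sum)
  then show ?thesis using assms by (auto simp: gh algebra_simps)
qed

lemma heis_box_cat_aut:
  assumes "heis_box r g" "1 \<le> r"
  shows "heis_box (cat_eig * r) (cat_aut g)"
proof -
  obtain x y z where g: "g = Heis x y z" by (cases g)
  define X Y Z where "X = real_of_int x" "Y = real_of_int y" "Z = real_of_int z"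
  define t where "t = cat_eig - 2"
  have t: "1 / 2 < t" "t < 1" "t * cat_eig = 1 + t"
    using cat_eig_bounds cat_eig_sq by (auto simp: t_def algebra_simps)
  have b: "\<bar>X\<bar> \<le> r\<^sup>2" "\<bar>Y\<bar> \<le> r" "\<bar>Z\<bar> \<le> t * r"
    using assms(1) by (auto simp: g X_Y_Z_def t_def)
  have Zr: "\<bar>Z\<bar> \<le> r" using b(3) mult_right_mono[of t 1 r] t assms(2) by linarith
  \<comment> \<open>A product of consecutive integers is even, so the integer division is
    exact.\<close>
  have half: "real_of_int (z * (z - 1) div 2) = Z * (Z - 1) / 2"
    by (subst real_of_int_div) (auto simp: X_Y_Z_def)
  have rr: "r \<le> r\<^sup>2" using assms(2) by (simp add: power2_eq_square)
  have "\<bar>Z * Z\<bar> \<le> r * r" "\<bar>Y * Y\<bar> \<le> r * r" "\<bar>Y * Z\<bar> \<le> r * r"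
    unfolding abs_mult using b(2) Zr assms(2) by (intro mult_mono; linarith)+
  \<comment> \<open>The summands are at most 1, 1, 2 and 1 times \<open>r\<^sup>2\<close>, linear
    terms being absorbed by \<open>rr\<close>. The roomier 6 is still below
    \<open>cat_eig\<^sup>2\<close>.\<close>
  then have "\<bar>X + Z * (Z - 1) / 2 + Y * (Y - 1) + Y * Z\<bar> \<le> 6 * r\<^sup>2"
    using b(1,2) Zr rr unfolding power2_eq_square right_diff_distrib mult_1_right diff_divide_distrib
    by linarith
  also have "\<dots> \<le> (cat_eig * r)\<^sup>2"
    unfolding power_mult_distrib using cat_eig_sq cat_eig_bounds
    by (intro mult_right_mono) (auto simp: power2_eq_square)
  finally have 1: "\<bar>X + Z * (Z - 1) / 2 + Y * (Y - 1) + Y * Z\<bar> \<le> (cat_eig * r)\<^sup>2" .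
  have 2: "\<bar>2 * Y + Z\<bar> \<le> cat_eig * r"
    using b by (auto simp: t_def algebra_simps)
  have "t * (cat_eig * r) = r + t * r" using t(3) by (metis mult.assoc distrib_right mult_1)
  then have 3: "\<bar>Y + Z\<bar> \<le> t * (cat_eig * r)"
    using b by linarith
  have "cat_aut g = Heis (x + z * (z - 1) div 2 + y * (y - 1) + y * z) (2 * y + z) (y + z)"
    by (simp add: g)
  with 1 2 3 show ?thesis
    by (simp add: half t_def) (simp add: X_Y_Z_def)
qed

lemma heis_box_cat_aut_pow:
  assumes "heis_box r g" "1 \<le> r"
  shows "heis_box (cat_eig ^ n * r) ((cat_aut ^^ n) g)"
proof (induction n)
  case (Suc n)
  have "1 * 1 \<le> cat_eig ^ n * r"
    using assms(2) cat_eig_bounds by (intro mult_mono one_le_power) auto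
  then show ?case using heis_box_cat_aut[OF Suc] by (simp add: mult.assoc)
qed (use assms in simp)

lemma finite_heis_box:
  assumes S: "finite S"
  shows "\<exists>r\<ge>1. \<forall>g\<in>S. heis_box r g"
  using S
proof induction
  case empty
  show ?case by (rule exI[of _ 1]) simp
next
  case (insert g S)
  then obtain r where r: "1 \<le> r" "\<forall>h\<in>S. heis_box r h" by auto
  obtain x y z where g: "g = Heis x y z" by (cases g)
  \<comment> \<open>The summand 1 gives \<open>s \<le> s * s\<close>; the factor 2 compensates for
    \<open>cat_eig - 2\<close> being only known to exceed 1/2.\<close>
  define s where "s = 1 + \<bar>real_of_int x\<bar> + \<bar>real_of_int y\<bar> + 2 * \<bar>real_of_int z\<bar>"
  have "1 * s \<le> s * s" by (intro mult_right_mono) (auto simp: s_def)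
  moreover have "\<bar>real_of_int x\<bar> \<le> s" by (simp add: s_def)
  ultimately have "\<bar>real_of_int x\<bar> \<le> s\<^sup>2" unfolding power2_eq_square by linarith
  moreover have "\<bar>real_of_int z\<bar> \<le> (cat_eig - 2) * s"
  proof -
    have "\<bar>real_of_int z\<bar> \<le> 1 / 2 * s" by (simp add: s_def)
    also have "\<dots> \<le> (cat_eig - 2) * s"
      using cat_eig_bounds by (intro mult_right_mono) (auto simp: s_def)
    finally show ?thesis .
  qed
  ultimately have "heis_box s g" by (simp add: g) (simp add: s_def)
  then have "\<forall>h\<in>insert g S. heis_box (max r s) h"
    using r(2) heis_box_mono by (metis insert_iff max.cobounded1 max.cobounded2)
  then show ?case using r(1) by (intro exI[of _ "max r s"]) auto
qed

text \<open>The central coordinate has order \<open>r\<^sup>2\<close> values and the other two order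
  \<open>r\<close> each: this exponent 4 becomes the factor 4 in the entropy bound. Each of the
  three intervals costs a factor 3.\<close>

lemma card_heis_box:
  assumes "1 \<le> r"
  shows "finite {g. heis_box r g}" "real (card {g. heis_box r g}) \<le> 27 * r ^ 4"
proof -
  define I where "I R = {- \<lfloor>R\<rfloor>..\<lfloor>R :: real\<rfloor>}" for R
  have mem: "k \<in> I R" if "\<bar>real_of_int k\<bar> \<le> R" for k R
    using that by (auto simp: I_def le_floor_iff minus_le_iff[of _ k])
  have cI: "real (card (I R)) \<le> 3 * R" if "1 \<le> R" for R
  proof -
    have "real (card (I R)) = 2 * real_of_int \<lfloor>R\<rfloor> + 1" using that by (simp add: I_def)
    then show ?thesis using that of_int_floor_le[of R] by linarith
  qed
  let ?P = "I (r\<^sup>2) \<times> I r \<times> I r"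
  have sub: "{g. heis_box r g} \<subseteq> (\<lambda>(x, y, z). Heis x y z) ` ?P"
  proof
    fix g assume g: "g \<in> {g. heis_box r g}"
    obtain x y z where xyz: "g = Heis x y z" by (cases g)
    have "\<bar>real_of_int z\<bar> \<le> r"
      using g mult_right_mono[of "cat_eig - 2" 1 r] assms cat_eig_bounds
      unfolding xyz mem_Collect_eq heis_box.simps by linarith
    then have "(x, y, z) \<in> ?P" using g by (auto simp: xyz intro: mem)
    then show "g \<in> (\<lambda>(x, y, z). Heis x y z) ` ?P" by (force simp: xyz)
  qed
  have fin: "finite ?P" by (simp add: I_def)
  show "finite {g. heis_box r g}" using sub fin by (meson finite_imageI finite_subset)
  have "card {g. heis_box r g} \<le> card ?P"
    by (rule order_trans[OF card_mono[OF finite_imageI[OF fin] sub] card_image_le[OF fin]])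
  then have "real (card {g. heis_box r g}) \<le> real (card (I (r\<^sup>2))) * (real (card (I r)) * real (card (I r)))"
    unfolding card_cartesian_product by (simp flip: of_nat_mult)
  also have "\<dots> \<le> (3 * r\<^sup>2) * ((3 * r) * (3 * r))"
    using assms by (intro mult_mono cI) (auto simp: one_le_power)
  also have "\<dots> = 27 * r ^ 4" by (simp add: power2_eq_square power4_eq_xxxx)
  finally show "real (card {g. heis_box r g}) \<le> 27 * r ^ 4" .
qed

text \<open>Since \<open>cat_eig\<close> exceeds 2, each power dominates the sum of the preceding
  ones.\<close>

lemma sum_power_cat_eig_le: "(\<Sum>i<n. cat_eig ^ i) \<le> cat_eig ^ n"
proof (induction n)
  case (Suc n)
  have "2 * cat_eig ^ n \<le> cat_eig * cat_eig ^ n"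
    using cat_eig_bounds by (intro mult_right_mono) auto
  then show ?case using Suc by simp
qed simp

lemma Entp_cat_aut_le: "Entp cat_aut \<le> ereal (4 * ln cat_eig)"
proof -
  have "Entp_at cat_aut \<Omega> \<delta> \<le> ereal (ln (cat_eig ^ 4))" if \<Omega>: "finite \<Omega>" and \<delta>: "0 < \<delta>" for \<Omega> \<delta>
  proof -
    define S where "S = (\<Union>f\<in>\<Omega>. Poly_Mapping.keys f)"
    have "finite S" using \<Omega> by (simp add: S_def)
    then obtain r where r: "1 \<le> r" "\<And>g. g \<in> S \<Longrightarrow> heis_box r g"
      using finite_heis_box by blast
    \<comment> \<open>The \<open>i\<close>-th factor lies in the box of radius
      \<open>cat_eig ^ i * r\<close>, and radii add under products. The empty sum gives the box of
      radius 0 around the identity.\<close>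
    define K where "K n = {g. heis_box ((\<Sum>i<n. cat_eig ^ i) * r) g}" for n
    show ?thesis
    proof (rule Entp_at_le[of "27 * r ^ 4"])
      show "0 < 27 * r ^ 4" "0 < cat_eig ^ 4" using r cat_eig_bounds by simp_all
      fix n
      have keys: "Poly_Mapping.keys f \<subseteq> K n" if "f \<in> orbit_products cat_aut \<Omega> n" for f
      proof (rule keys_orbit_products[OF _ _ _ that])
        show "Poly_Mapping.keys f \<subseteq> S" if "f \<in> \<Omega>" for f using that by (auto simp: S_def)
        show "0 \<in> K 0" by (simp add: K_def zero_heis_def)
        fix m g h assume "g \<in> K m" "h \<in> S"
        then show "g + (cat_aut ^^ m) h \<in> K (Suc m)"
          using heis_box_add heis_box_cat_aut_pow r by (simp add: K_def distrib_right)
      qed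
      let ?R = "cat_eig ^ n * r"
      have R: "1 * 1 \<le> ?R"
        using r cat_eig_bounds by (intro mult_mono one_le_power) auto
      have "(\<Sum>i<n. cat_eig ^ i) * r \<le> ?R"
        using r sum_power_cat_eig_le by (intro mult_right_mono) auto
      then have KR: "K n \<subseteq> {g. heis_box ?R g}" by (auto simp: K_def intro: heis_box_mono)
      have "approx_dim Cstar_red (reg_rep ` orbit_products cat_aut \<Omega> n) \<delta>
          \<le> enat (card {g. heis_box ?R g})"
        using keys KR card_heis_box(1)[of ?R] R \<delta> by (intro approx_dim_Cstar_red_le) auto
      moreover have "real (card {g. heis_box ?R g}) \<le> 27 * r ^ 4 * (cat_eig ^ 4) ^ n"
        using card_heis_box(2)[of ?R] R
        by (simp add: power_mult_distrib mult_ac flip: power_mult)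
      ultimately show "\<exists>m. approx_dim Cstar_red (reg_rep ` orbit_products cat_aut \<Omega> n) \<delta> \<le> enat m
          \<and> real m \<le> 27 * r ^ 4 * (cat_eig ^ 4) ^ n"
        by blast
    qed
  qed
  moreover have "ln (cat_eig ^ 4) = 4 * ln cat_eig"
    using cat_eig_bounds by (simp add: ln_realpow)
  ultimately show ?thesis unfolding Entp_def by (auto intro!: SUP_least)
qed

section \<open>Lower bound: the expanding coordinate\<close>

fun heis_expand :: "heis \<Rightarrow> real" where
  "heis_expand (Heis x y z) = real_of_int y + (cat_eig - 2) * real_of_int z"

lemma heis_expand_add: "heis_expand (g + h) = heis_expand g + heis_expand h"
  by (cases g; cases h) (simp add: algebra_simps)

text \<open>The cat matrix is symmetric, so pairing with its eigenvector
  \<open>(1, cat_eig - 2)\<close> gives an eigenfunctional.\<close>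

lemma heis_expand_cat_aut: "heis_expand (cat_aut g) = cat_eig * heis_expand g"
proof (cases g)
  case (Heis x y z)
  have "cat_eig * heis_expand g
      = cat_eig * real_of_int y + (cat_eig * cat_eig) * real_of_int z - 2 * cat_eig * real_of_int z"
    by (simp add: Heis distrib_left left_diff_distrib right_diff_distrib)
  also have "\<dots> = heis_expand (cat_aut g)"
    unfolding cat_eig_sq by (simp add: Heis distrib_left left_diff_distrib)
  finally show ?thesis by simp
qed

lemma heis_expand_cat_aut_pow: "heis_expand ((cat_aut ^^ n) g) = cat_eig ^ n * heis_expand g"
  by (induction n) (simp_all add: heis_expand_cat_aut)

abbreviation cat_digits :: "heis set" where
  "cat_digits \<equiv> {0, heis_alpha, heis_alpha + heis_alpha}"

text \<open>Greedy expansion in base \<open>cat_eig\<close>: remove the leading digit times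
  \<open>cat_eig ^ n\<close>, then expand the remainder. The digits 0, 1, 2 suffice because
  \<open>cat_eig < 3\<close>.\<close>

lemma orbit_sums_cat_dense:
  assumes "0 \<le> x" "x < cat_eig ^ n"
  shows "\<exists>g\<in>orbit_sums cat_aut cat_digits n. heis_expand g \<le> x \<and> x < heis_expand g + 1"
  using assms
proof (induction n arbitrary: x)
  case 0
  then show ?case by (simp add: orbit_sums_0 zero_heis_def)
next
  case (Suc n)
  let ?p = "cat_eig ^ n"
  have p: "0 < ?p" using cat_eig_bounds by simp
  have "x < 3 * ?p" using Suc.prems(2) mult_strict_right_mono[OF cat_eig_bounds(2) p] by simp
  moreover have "heis_expand 0 = 0" "heis_expand heis_alpha = 1"
    "heis_expand (heis_alpha + heis_alpha) = 2"
    by (simp_all add: zero_heis_def heis_alpha_def)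
  ultimately obtain d where d: "d \<in> cat_digits" "?p * heis_expand d \<le> x" "x < ?p * heis_expand d + ?p"
    using Suc.prems(1) p
    by (cases "x < ?p"; cases "x < 2 * ?p") (force simp: mult.commute)+
  obtain g where g: "g \<in> orbit_sums cat_aut cat_digits n"
      "heis_expand g \<le> x - ?p * heis_expand d" "x - ?p * heis_expand d < heis_expand g + 1"
    using Suc.IH[of "x - ?p * heis_expand d"] d by auto
  show ?case
  proof
    show "g + (cat_aut ^^ n) d \<in> orbit_sums cat_aut cat_digits (Suc n)"
      by (rule orbit_sums_SucI[OF g(1) d(1)])
  qed (use g in \<open>simp add: heis_expand_add heis_expand_cat_aut_pow\<close>)
qed

lemma orbit_sums_cat_card:
  "\<exists>F. finite F \<and> F \<subseteq> orbit_sums cat_aut cat_digits n \<and> cat_eig ^ n \<le> card F"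
proof -
  \<comment> \<open>With the ceiling, every natural number below \<open>N\<close> is still strictly
    below \<open>cat_eig ^ n\<close>.\<close>
  define N where "N = nat \<lceil>cat_eig ^ n\<rceil>"
  have N: "cat_eig ^ n \<le> real N" by (simp add: N_def real_nat_ceiling_ge)
  have "\<exists>g\<in>orbit_sums cat_aut cat_digits n. heis_expand g \<le> real k \<and> real k < heis_expand g + 1"
    if "k < N" for k
  proof -
    have "real k < cat_eig ^ n" using that by (simp add: N_def zless_nat_eq_int_zless less_ceiling_iff)
    from orbit_sums_cat_dense[OF _ this] show ?thesis by simp
  qed
  then obtain G where G: "\<And>k. k < N \<Longrightarrow> G k \<in> orbit_sums cat_aut cat_digits n
      \<and> heis_expand (G k) \<le> real k \<and> real k < heis_expand (G k) + 1"
    by metis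
  \<comment> \<open>A half-open interval of length 1 contains only one integer.\<close>
  have "inj_on G {..<N}"
  proof (rule inj_onI)
    fix j k assume "j \<in> {..<N}" "k \<in> {..<N}" "G j = G k"
    then have "real j < real k + 1" "real k < real j + 1" using G[of j] G[of k] by auto
    then show "j = k" by linarith
  qed
  then have "card (G ` {..<N}) = N" by (simp add: card_image)
  then show ?thesis using N G by (intro exI[of _ "G ` {..<N}"]) auto
qed

lemma Entp_cat_aut_ge: "ereal (ln cat_eig) \<le> Entp cat_aut"
proof -
  define \<Omega> :: "(heis \<Rightarrow>\<^sub>0 complex) set" where "\<Omega> = (\<lambda>g. Poly_Mapping.single g 1) ` cat_digits"
  have \<Omega>: "finite \<Omega>" "\<Omega> \<subseteq> Cc_unit_ball"
    by (auto simp: \<Omega>_def Cc_unit_ball_def red_norm_def reg_rep_single norm_left_translation_le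
        simp del: single_one)
  have "ereal (ln cat_eig) \<le> Entp_at cat_aut \<Omega> (1 / 2)"
  \<comment> \<open>The constant is \<open>(1 - \<delta>\<^sup>2) / 2\<close> at
    \<open>\<delta> = 1 / 2\<close>.\<close>
  proof (rule Entp_at_ge[of "3 / 8"])
    show "0 < cat_eig" using cat_eig_bounds by simp
    fix n
    obtain F where F: "finite F" "F \<subseteq> orbit_sums cat_aut cat_digits n" "cat_eig ^ n \<le> card F"
      using orbit_sums_cat_card by blast
    have "left_translation ` F \<subseteq> reg_rep ` orbit_products cat_aut \<Omega> n"
      unfolding \<Omega>_def using F(2) single_orbit_sums
      by (force simp flip: reg_rep_single)
    from approx_dim_ge[OF F(1) this, of "1 / 2"]
    have "enat (nat \<lceil>3 / 8 * real (card F)\<rceil>)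
        \<le> approx_dim Cstar_red (reg_rep ` orbit_products cat_aut \<Omega> n) (1 / 2)"
      by (simp add: power2_eq_square)
    moreover have "3 / 8 * cat_eig ^ n \<le> real (nat \<lceil>3 / 8 * real (card F)\<rceil>)"
      using F(3) real_nat_ceiling_ge[of "3 / 8 * real (card F)"] by linarith
    ultimately show "\<exists>m. enat m \<le> approx_dim Cstar_red (reg_rep ` orbit_products cat_aut \<Omega> n) (1 / 2)
        \<and> 3 / 8 * cat_eig ^ n \<le> real m" by blast
  qed simp
  also have "\<dots> \<le> Entp cat_aut"
    unfolding Entp_def by (rule SUP_upper2[where i = \<Omega>]) (use \<Omega> in \<open>auto intro!: SUP_upper\<close>)
  finally show ?thesis .
qed

theorem proposition3p20:
  fixes \<phi> :: "heis \<Rightarrow> heis"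
  assumes "group_automorphism \<phi>"
    and "\<phi> heis_alpha = Heis 0 2 1"
    and "\<phi> heis_beta = Heis 0 1 1"
  shows "ereal (ln ((3 + sqrt 5) / 2)) \<le> Entp \<phi> \<and>
         Entp \<phi> \<le> ereal (4 * ln ((3 + sqrt 5) / 2))"
proof -
  \<comment> \<open>A homomorphism is determined by its values at the two generators.\<close>
  have "\<phi> = cat_aut"
    using assms group_automorphism_cat_aut
    by (intro heis_generators_ext) (auto simp: group_automorphism_def heis_alpha_def heis_beta_def)
  then show ?thesis
    using Entp_cat_aut_ge Entp_cat_aut_le by (simp add: cat_eig_def)
qed

end
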